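(* Let $E_1,E_2,F_1,F_2$ be locally convex Hausdorff spaces and, for $i,j\in\{1,2\}$, let $A_{ij}$ be a densely defined linear operator from $E_j$ to $F_i$, such that $\mathcal D(A_{1j})\cap\mathcal D(A_{2j})$ is dense in $E_j$ for $j=1,2$. Let $A=\begin{pmatrix} A_{11} & A_{12} \\ A_{21} & A_{22} \end{pmatrix}$ be the associated operator matrix from $E=E_1\oplus E_2$ to $F=F_1\oplus F_2$ and let $A^\times$ be its formal adjoint. Then: (1) $A^\times\subset A'$. (2) $A^\times$ is closable. (3) If $A^\times$ is densely defined, then $A$ is closable.
   Context: Operators are linear and defined on linear subspaces; $\mathcal D(T)$ is the domain of $T$. $S\subset T$ means $\mathcal D(S)\subset\mathcal D(T)$ and $S=T$ on $\mathcal D(S)$. An operator is closed if its graph is closed in the product space, and closable if the closure of its graph is the graph of an operator. The operator matrix $A$ has domain $\mathcal D(A)=(\mathcal D(A_{11})\cap\mathcal D(A_{21}))\oplus(\mathcal D(A_{12})\cap\mathcal D(A_{22}))$ and acts by $A(f_1\oplus f_2)=(A_{11}f_1+A_{12}f_2)\oplus(A_{21}f_1+A_{22}f_2)$. For a densely defined operator $T$ from a locally convex Hausdorff space $X$ to a locally convex Hausdorff space $Y$, the adjoint $T'$ is the operator from the topological dual $Y'$ to $X'$ with $\mathcal D(T')=\{g\in Y' : \exists h\in X' \ \forall f\in\mathcal D(T)\ \langle Tf,g\rangle=\langle f,h\rangle\}$ and $T'g=h$. The dual of a finite direct sum is identified with the direct sum of the duals. Dual spaces carry the weak-$*$ topology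 (so density, closedness and closability in dual spaces refer to it). The formal adjoint of $A$ is the operator matrix $A^\times=\begin{pmatrix} A_{11}' & A_{21}' \\ A_{12}' & A_{22}' \end{pmatrix}$ from $F'=F_1'\oplus F_2'$ to $E'=E_1'\oplus E_2'$, with $\mathcal D(A^\times)=(\mathcal D(A_{11}')\cap\mathcal D(A_{12}'))\oplus(\mathcal D(A_{21}')\cap\mathcal D(A_{22}'))$. *)

theory Defs
  imports "HOL-Analysis.Analysis" "HOL-Library.Function_Algebras"
begin

text \<open>The scalar field is either the reals or the complex numbers. The witness \<open>i\<close> is \<open>0\<close> in the
  first case and an imaginary unit in the second.\<close>

class real_or_complex = real_normed_field +
  assumes real_or_complex:
    "\<exists>i. (i = 0 \<or> i * i = - 1) \<and> (\<forall>z. \<exists>a b. z = scaleR a 1 + scaleR b i)"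

instance real :: real_or_complex
proof
  have "\<exists>a b. z = a *\<^sub>R 1 + b *\<^sub>R 0" for z :: real
    by (rule exI[of _ z]) simp
  then show "\<exists>i::real. (i = 0 \<or> i * i = - 1) \<and> (\<forall>z. \<exists>a b. z = a *\<^sub>R 1 + b *\<^sub>R i)"
    by blast
qed

instance complex :: real_or_complex
proof
  have "\<exists>a b. z = a *\<^sub>R 1 + b *\<^sub>R \<i>" for z
    by (rule exI[of _ "Re z"], rule exI[of _ "Im z"]) (simp add: complex_eq_iff)
  then show "\<exists>i::complex. (i = 0 \<or> i * i = - 1) \<and> (\<forall>z. \<exists>a b. z = a *\<^sub>R 1 + b *\<^sub>R i)"
    by (intro exI[of _ \<i>]) auto
qed


subsection \<open>Locally convex Hausdorff spaces and their duals\<close>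

text \<open>Addition and the Hausdorff topology come from the type; only the scalar multiplication is an
  explicit parameter, because the scalar field is a type variable.\<close>

locale locally_convex_hausdorff_space = vector_space scale
  for scale :: "'k::real_or_complex \<Rightarrow> 'a::{topological_ab_group_add, t2_space} \<Rightarrow> 'a" +
  assumes continuous_scale: "continuous_on UNIV (\<lambda>(c, x). scale c x)"
    and locally_convex: "open U \<Longrightarrow> 0 \<in> U \<Longrightarrow>
      \<exists>V. open V \<and> 0 \<in> V \<and> V \<subseteq> U \<and>
        (\<forall>x\<in>V. \<forall>y\<in>V. \<forall>t\<in>{0..1}. scale (of_real (1 - t)) x + scale (of_real t) y \<in> V)"

definition prod_scale :: "('k \<Rightarrow> 'a \<Rightarrow> 'a) \<Rightarrow> ('k \<Rightarrow> 'b \<Rightarrow> 'b) \<Rightarrow> 'k \<Rightarrow> 'a \<times> 'b \<Rightarrow> 'a \<times> 'b" where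
  "prod_scale sX sY c = (\<lambda>(x, y). (sX c x, sY c y))"

definition fun_scale :: "'k::times \<Rightarrow> ('a \<Rightarrow> 'k) \<Rightarrow> 'a \<Rightarrow> 'k" where
  "fun_scale c g = (\<lambda>x. c * g x)"

definition dual ::
    "('k::real_or_complex \<Rightarrow> 'a::{ab_group_add, topological_space} \<Rightarrow> 'a) \<Rightarrow> ('a \<Rightarrow> 'k) set" where
  "dual sX = {g. Vector_Spaces.linear sX (*) g \<and> continuous_on UNIV g}"

text \<open>The weak-$*$ topology is the topology of pointwise convergence on the dual.\<close>

definition weak_star ::
    "('k::real_or_complex \<Rightarrow> 'a::{ab_group_add, topological_space} \<Rightarrow> 'a) \<Rightarrow> ('a \<Rightarrow> 'k) topology" where
  "weak_star sX = subtopology (product_topology (\<lambda>_. euclidean) UNIV) (dual sX)"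

text \<open>The identification of \<open>X' \<oplus> Y'\<close> with \<open>(X \<oplus> Y)'\<close> and its inverse.\<close>

definition join_dual :: "('a \<Rightarrow> 'k) \<times> ('b \<Rightarrow> 'k) \<Rightarrow> 'a \<times> 'b \<Rightarrow> 'k::plus" where
  "join_dual = (\<lambda>(g, h) (x, y). g x + h y)"

definition split_dual :: "('a::zero \<times> 'b::zero \<Rightarrow> 'k) \<Rightarrow> ('a \<Rightarrow> 'k) \<times> ('b \<Rightarrow> 'k)" where
  "split_dual g = ((\<lambda>x. g (x, 0)), (\<lambda>y. g (0, y)))"

lemma topspace_weak_star [simp]: "topspace (weak_star sX) = dual sX"
  by (simp add: weak_star_def)

lemma vector_space_prod_scale:
  assumes "vector_space sX" "vector_space sY"
  shows "vector_space (prod_scale sX sY)"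
proof -
  interpret X: vector_space sX by fact
  interpret Y: vector_space sY by fact
  show ?thesis
    by unfold_locales
      (auto simp: prod_scale_def X.scale_right_distrib Y.scale_right_distrib
        X.scale_left_distrib Y.scale_left_distrib)
qed

lemma homeomorphic_maps_join_split_dual:
  fixes sX :: "'k::real_or_complex \<Rightarrow> 'a::{ab_group_add, topological_space} \<Rightarrow> 'a"
    and sY :: "'k \<Rightarrow> 'b::{ab_group_add, topological_space} \<Rightarrow> 'b"
  assumes X: "vector_space sX" and Y: "vector_space sY"
  shows "homeomorphic_maps (prod_topology (weak_star sX) (weak_star sY))
           (weak_star (prod_scale sX sY)) join_dual split_dual"
proof -
  have K: "vector_space ((*) :: 'k \<Rightarrow> 'k \<Rightarrow> 'k)"
    by unfold_locales (auto simp: algebra_simps)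
  have lin: "Vector_Spaces.linear s (*) g \<longleftrightarrow>
      (\<forall>x y. g (x + y) = g x + g y) \<and> (\<forall>c x. g (s c x) = c * g x)"
    if "vector_space s" for s :: "'k \<Rightarrow> 'c::ab_group_add \<Rightarrow> 'c" and g
    using that K by (simp add: Vector_Spaces.linear_iff)
  note lin = lin[OF X] lin[OF Y] lin[OF vector_space_prod_scale[OF X Y]]
  have lin_0: "g 0 = 0" if "Vector_Spaces.linear s (*) g"
    for s :: "'k \<Rightarrow> 'c::ab_group_add \<Rightarrow> 'c" and g
  proof -
    interpret Vector_Spaces.linear s "(*)" g by fact
    show ?thesis by (rule zero)
  qed
  have join: "join_dual p \<in> dual (prod_scale sX sY)" if "p \<in> dual sX \<times> dual sY" for p
  proof -
    obtain g h where p: "p = (g, h)" "g \<in> dual sX" "h \<in> dual sY"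
      using \<open>p \<in> dual sX \<times> dual sY\<close> by (cases p) auto
    have "continuous_on UNIV (\<lambda>z::'a \<times> 'b. g (fst z))"
      by (rule continuous_on_compose2[of UNIV g]) (use p in \<open>auto simp: dual_def intro: continuous_intros\<close>)
    moreover have "continuous_on UNIV (\<lambda>z::'a \<times> 'b. h (snd z))"
      by (rule continuous_on_compose2[of UNIV h]) (use p in \<open>auto simp: dual_def intro: continuous_intros\<close>)
    ultimately show ?thesis
      using p by (simp add: dual_def lin join_dual_def prod_scale_def algebra_simps split_def
          continuous_on_add)
  qed
  have split: "split_dual g \<in> dual sX \<times> dual sY" if g: "g \<in> dual (prod_scale sX sY)" for g
  proof -
    have add: "g (z + w) = g z + g w" and sc: "g (prod_scale sX sY c z) = c * g z" for z w c
      using g by (simp_all add: dual_def lin del: split_paired_All)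
    have cont: "continuous_on UNIV g"
      using g by (simp add: dual_def)
    have sX0: "sX c 0 = 0" and sY0: "sY c 0 = 0" for c
      using X Y by (simp_all add: module.scale_zero_right module_iff_vector_space)
    have "g (x + x', 0) = g (x, 0) + g (x', 0)" "g (sX c x, 0) = c * g (x, 0)" for x x' c
      using add[of "(x, 0)" "(x', 0)"] sc[of c "(x, 0)"] by (simp_all add: prod_scale_def sY0)
    then have "Vector_Spaces.linear sX (*) (\<lambda>x. g (x, 0))"
      by (simp add: lin)
    moreover have "g (0, y + y') = g (0, y) + g (0, y')" "g (0, sY c y) = c * g (0, y)" for y y' c
      using add[of "(0, y)" "(0, y')"] sc[of c "(0, y)"] by (simp_all add: prod_scale_def sX0)
    then have "Vector_Spaces.linear sY (*) (\<lambda>y. g (0, y))"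
      by (simp add: lin)
    moreover have "continuous_on UNIV (\<lambda>x. g (x, 0))" "continuous_on UNIV (\<lambda>y. g (0, y))"
      by (auto intro!: continuous_on_compose2[OF cont] continuous_intros)
    ultimately show ?thesis
      by (simp add: split_dual_def dual_def)
  qed
  have apply_cont: "continuous_map (weak_star s) euclidean (\<lambda>g. g x)"
    for s :: "'k \<Rightarrow> 'c::{ab_group_add, topological_space} \<Rightarrow> 'c" and x
    unfolding weak_star_def by (intro continuous_map_from_subtopology continuous_map_product_projection) simp
  have "continuous_map (prod_topology (weak_star sX) (weak_star sY)) euclidean (\<lambda>p. join_dual p z)" for z
    unfolding join_dual_def split_def
    by (intro continuous_map_add
        continuous_map_compose[OF continuous_map_fst apply_cont, unfolded comp_def]
        continuous_map_compose[OF continuous_map_snd apply_cont, unfolded comp_def])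
  then have 1: "continuous_map (prod_topology (weak_star sX) (weak_star sY))
      (weak_star (prod_scale sX sY)) join_dual"
    unfolding weak_star_def[of "prod_scale sX sY"]
    using join by (auto simp: continuous_map_in_subtopology continuous_map_componentwise_UNIV)
  have 2: "continuous_map (weak_star (prod_scale sX sY)) (prod_topology (weak_star sX) (weak_star sY))
      split_dual"
    unfolding split_dual_def
    using split apply_cont
    by (auto simp: continuous_map_pairwise weak_star_def[of sX] weak_star_def[of sY] comp_def
        continuous_map_in_subtopology continuous_map_componentwise_UNIV split_dual_def)
  have 3: "split_dual (join_dual p) = p" if "p \<in> dual sX \<times> dual sY" for p
    using that by (auto simp: split_dual_def join_dual_def dual_def dest!: lin_0)
  have 4: "join_dual (split_dual g) = g" if g: "g \<in> dual (prod_scale sX sY)" for g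
  proof -
    have "g (z + w) = g z + g w" for z w
      using g by (simp_all add: dual_def lin del: split_paired_All)
    then have "g (x, 0) + g (0, y) = g (x, y)" for x y
      by (metis add.left_neutral add.right_neutral add_Pair)
    then show ?thesis
      by (auto simp: split_dual_def join_dual_def)
  qed
  show ?thesis
    using 1 2 3 4 by (auto simp: homeomorphic_maps_def)
qed


subsection \<open>Operators\<close>

text \<open>The values of \<open>app T\<close> outside the domain \<open>dmn T\<close> are irrelevant.\<close>

datatype ('a, 'b) operator = Operator (dmn: "'a set") (app: "'a \<Rightarrow> 'b")

definition op_graph :: "('a, 'b) operator \<Rightarrow> ('a \<times> 'b) set" where
  "op_graph T = {(x, app T x) | x. x \<in> dmn T}"

definition op_le :: "('a, 'b) operator \<Rightarrow> ('a, 'b) operator \<Rightarrow> bool" where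
  "op_le S T \<longleftrightarrow> dmn S \<subseteq> dmn T \<and> (\<forall>x\<in>dmn S. app S x = app T x)"

text \<open>In the following, \<open>X\<close> and \<open>Y\<close> are the topologies of the two spaces and
  \<open>topspace X\<close>, \<open>topspace Y\<close> their underlying vector spaces; the latter need not be whole types
  (as for dual spaces). For the given spaces, \<open>X\<close> is \<open>euclidean\<close>, the topology of the type.\<close>

definition linear_operator ::
    "('k::field \<Rightarrow> 'a::ab_group_add \<Rightarrow> 'a) \<Rightarrow> 'a topology \<Rightarrow> ('k \<Rightarrow> 'b::ab_group_add \<Rightarrow> 'b) \<Rightarrow> 'b topology
      \<Rightarrow> ('a, 'b) operator \<Rightarrow> bool" where
  "linear_operator sX X sY Y T \<longleftrightarrow>
     module.subspace sX (dmn T) \<and> dmn T \<subseteq> topspace X \<and> app T ` dmn T \<subseteq> topspace Y \<and>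
     (\<forall>x\<in>dmn T. \<forall>y\<in>dmn T. app T (x + y) = app T x + app T y) \<and>
     (\<forall>c. \<forall>x\<in>dmn T. app T (sX c x) = sY c (app T x))"

definition densely_defined :: "'a topology \<Rightarrow> ('a, 'b) operator \<Rightarrow> bool" where
  "densely_defined X T \<longleftrightarrow> X closure_of dmn T = topspace X"

definition closable ::
    "('k::field \<Rightarrow> 'a::ab_group_add \<Rightarrow> 'a) \<Rightarrow> 'a topology \<Rightarrow> ('k \<Rightarrow> 'b::ab_group_add \<Rightarrow> 'b) \<Rightarrow> 'b topology
      \<Rightarrow> ('a, 'b) operator \<Rightarrow> bool" where
  "closable sX X sY Y T \<longleftrightarrow>
     (\<exists>S. linear_operator sX X sY Y S \<and> op_graph S = prod_topology X Y closure_of op_graph T)"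

text \<open>The functional \<open>h\<close> below is unique, hence \<open>THE\<close> is meaningful, when \<open>T\<close> is densely defined.\<close>

definition op_adjoint ::
    "('k::real_or_complex \<Rightarrow> 'a::{ab_group_add, topological_space} \<Rightarrow> 'a) \<Rightarrow>
     ('k \<Rightarrow> 'b::{ab_group_add, topological_space} \<Rightarrow> 'b) \<Rightarrow>
     ('a, 'b) operator \<Rightarrow> ('b \<Rightarrow> 'k, 'a \<Rightarrow> 'k) operator" where
  "op_adjoint sX sY T = Operator
     {g \<in> dual sY. \<exists>h\<in>dual sX. \<forall>f\<in>dmn T. g (app T f) = h f}
     (\<lambda>g. THE h. h \<in> dual sX \<and> (\<forall>f\<in>dmn T. g (app T f) = h f))"

definition op_matrix ::
    "('a, 'c) operator \<Rightarrow> ('b, 'c) operator \<Rightarrow> ('a, 'd) operator \<Rightarrow> ('b, 'd) operator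
      \<Rightarrow> ('a \<times> 'b, 'c::plus \<times> 'd::plus) operator" where
  "op_matrix A11 A12 A21 A22 = Operator
     ((dmn A11 \<inter> dmn A21) \<times> (dmn A12 \<inter> dmn A22))
     (\<lambda>(f1, f2). (app A11 f1 + app A12 f2, app A21 f1 + app A22 f2))"

text \<open>The operator matrix of the adjoints maps \<open>F1' \<oplus> F2'\<close> to \<open>E1' \<oplus> E2'\<close>; it is regarded as an
  operator from \<open>(F1 \<oplus> F2)'\<close> to \<open>(E1 \<oplus> E2)'\<close> by means of the identification above.\<close>

definition on_dual_sums ::
    "(('c::zero \<Rightarrow> 'k) \<times> ('d::zero \<Rightarrow> 'k), ('a \<Rightarrow> 'k) \<times> ('b \<Rightarrow> 'k)) operator
      \<Rightarrow> ('c \<times> 'd \<Rightarrow> 'k, 'a \<times> 'b \<Rightarrow> 'k::plus) operator" where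
  "on_dual_sums T = Operator (join_dual ` dmn T) (\<lambda>g. join_dual (app T (split_dual g)))"

definition formal_adjoint ::
    "('k::real_or_complex \<Rightarrow> 'a::{ab_group_add, topological_space} \<Rightarrow> 'a) \<Rightarrow>
     ('k \<Rightarrow> 'b::{ab_group_add, topological_space} \<Rightarrow> 'b) \<Rightarrow>
     ('k \<Rightarrow> 'c::{ab_group_add, topological_space} \<Rightarrow> 'c) \<Rightarrow>
     ('k \<Rightarrow> 'd::{ab_group_add, topological_space} \<Rightarrow> 'd) \<Rightarrow>
     ('a, 'c) operator \<Rightarrow> ('b, 'c) operator \<Rightarrow> ('a, 'd) operator \<Rightarrow> ('b, 'd) operator \<Rightarrow>
     ('c \<times> 'd \<Rightarrow> 'k, 'a \<times> 'b \<Rightarrow> 'k) operator" where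
  "formal_adjoint sE1 sE2 sF1 sF2 A11 A12 A21 A22 = on_dual_sums
     (op_matrix (op_adjoint sE1 sF1 A11) (op_adjoint sE1 sF2 A21)
                (op_adjoint sE2 sF1 A12) (op_adjoint sE2 sF2 A22))"

end

theory Submission
  imports Defs
begin

text \<open>Parts (1) and (2): on \<open>\<D>(A)\<close> the functional \<open>g \<circ> A\<close> is given by \<open>A\<^sup>\<times> g\<close>, which determines
  \<open>A' g\<close> by density. The graph of \<open>A'\<close> is weak-$*$ closed, being cut out by the equations
  \<open>g (A f) = h f\<close>, so the closure of the graph of \<open>A\<^sup>\<times>\<close> stays single-valued. Part (3): if \<open>(x, y)\<close>
  and \<open>(x, y')\<close> lie in the closure of the graph of \<open>A\<close>, then \<open>g y = (A\<^sup>\<times> g) x = g y'\<close> for \<open>g\<close> in the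
  domain of \<open>A\<^sup>\<times>\<close>, hence by density for all \<open>g\<close> in the dual, which separates points by the
  Hahn--Banach theorem.\<close>

subsection \<open>Sublinear functionals and the Hahn--Banach theorem\<close>

text \<open>Only strictly positive factors are required in the homogeneity; the value 0 at 0 then
  follows by taking the factor 2.\<close>

definition sublinear :: "(real \<Rightarrow> 'a::ab_group_add \<Rightarrow> 'a) \<Rightarrow> ('a \<Rightarrow> real) \<Rightarrow> bool" where
  "sublinear s p \<longleftrightarrow> (\<forall>x y. p (x + y) \<le> p x + p y) \<and> (\<forall>r x. 0 < r \<longrightarrow> p (s r x) = r * p x)"

text \<open>The real multiplication is an explicit parameter, so that a space over \<open>'k\<close>
  can be viewed as a real one through \<open>of_real\<close>.\<close>

locale real_scalar_space = vector_space s for s :: "real \<Rightarrow> 'a::ab_group_add \<Rightarrow> 'a"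
begin

lemma sublinear_add: "sublinear s p \<Longrightarrow> p (x + y) \<le> p x + p y"
  by (simp add: sublinear_def)

lemma sublinear_scale: "sublinear s p \<Longrightarrow> 0 < r \<Longrightarrow> p (s r x) = r * p x"
  by (simp add: sublinear_def)

lemma sublinear_0: "sublinear s p \<Longrightarrow> p 0 = 0"
  using sublinear_scale[of p 2 0] by simp

lemma sublinear_minus: "sublinear s p \<Longrightarrow> - p (- x) \<le> p x"
  using sublinear_add[of p x "- x"] sublinear_0[of p] by simp

text \<open>Supplies the lower bounds for Zorn's lemma. For \<open>q\<close> and \<open>r\<close> in
  the chain, the smaller of the two shows that the infimum at \<open>x + y\<close> is at most
  \<open>q x + r y\<close>; then the infima over \<open>q\<close> and over \<open>r\<close> can be
  taken separately.\<close>

lemma sublinear_INF_chain: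
  assumes ne: "C \<noteq> {}" and sub: "\<And>q. q \<in> C \<Longrightarrow> sublinear s q"
    and chain: "\<And>q r. q \<in> C \<Longrightarrow> r \<in> C \<Longrightarrow> q \<le> r \<or> r \<le> q"
    and bdd: "\<And>x. bdd_below ((\<lambda>q. q x) ` C)"
  shows "sublinear s (\<lambda>x. INF q\<in>C. q x)"
proof -
  have low: "(INF q\<in>C. q x) \<le> q x" if "q \<in> C" for q x
    by (rule cINF_lower[OF bdd that])
  have "(INF q\<in>C. q (x + y)) \<le> (INF q\<in>C. q x) + (INF q\<in>C. q y)" for x y
  proof -
    have *: "(INF q\<in>C. q (x + y)) \<le> q x + r y" if "q \<in> C" "r \<in> C" for q r
      using chain[OF that]
    proof
      assume "q \<le> r"
      then have "q y \<le> r y" by (simp add: le_fun_def)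
      then show ?thesis
        using low[OF that(1), of "x + y"] sublinear_add[OF sub[OF that(1)], of x y] by linarith
    next
      assume "r \<le> q"
      then have "r x \<le> q x" by (simp add: le_fun_def)
      then show ?thesis
        using low[OF that(2), of "x + y"] sublinear_add[OF sub[OF that(2)], of x y] by linarith
    qed
    have "(INF q\<in>C. q (x + y)) - r y \<le> (INF q\<in>C. q x)" if "r \<in> C" for r
      by (rule cINF_greatest[OF ne]) (use *[OF _ that] in \<open>simp add: algebra_simps\<close>)
    then have "(INF q\<in>C. q (x + y)) - (INF q\<in>C. q x) \<le> (INF r\<in>C. r y)"
      by (intro cINF_greatest[OF ne]) (simp add: algebra_simps)
    then show ?thesis by simp
  qed
  moreover have "(INF q\<in>C. q (s r x)) = r * (INF q\<in>C. q x)" if "0 < r" for r x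
  proof (rule antisym)
    have "(INF q\<in>C. q (s r x)) / r \<le> (INF q\<in>C. q x)"
      by (rule cINF_greatest[OF ne])
        (use low[of _ "s r x"] sublinear_scale[OF sub that] that in \<open>simp add: field_simps\<close>)
    then show "(INF q\<in>C. q (s r x)) \<le> r * (INF q\<in>C. q x)"
      using that by (simp add: field_simps)
    show "r * (INF q\<in>C. q x) \<le> (INF q\<in>C. q (s r x))"
    proof (rule cINF_greatest[OF ne])
      fix q assume "q \<in> C"
      then show "r * (INF q\<in>C. q x) \<le> q (s r x)"
        using low[of q x] sublinear_scale[OF sub[of q] that] that by simp
    qed
  qed
  ultimately show ?thesis by (simp add: sublinear_def)
qed

text \<open>The functional is the infimum over \<open>t \<ge> 0\<close> of
  \<open>p (x + t y) - t p y\<close>. The choice \<open>t = 0\<close> gives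
  \<open>q \<le> p\<close>, and \<open>t = 1\<close> at the point \<open>- y\<close> gives the last
  bound.\<close>

lemma sublinear_lower:
  assumes p: "sublinear s p"
  obtains q where "sublinear s q" "q \<le> p" "q (- y) \<le> - p y"
proof
  define q where "q x = (INF t\<in>{0..}. p (x + s t y) - t * p y)" for x
  have pty: "p (s t y) = t * p y" if "0 \<le> t" for t
    using that sublinear_scale[OF p, of t y] sublinear_0[OF p] by (cases "t = 0") auto
  \<comment> \<open>Writing \<open>t y\<close> as \<open>- x + (x + t y)\<close> gives a lower bound
    independent of \<open>t\<close>.\<close>
  have bdd: "bdd_below ((\<lambda>t. p (x + s t y) - t * p y) ` {0..})" for x
  proof (rule bdd_belowI2)
    fix t :: real assume "t \<in> {0..}"
    then show "- p (- x) \<le> p (x + s t y) - t * p y"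
      using sublinear_add[OF p, of "- x" "x + s t y"] pty[of t] by simp
  qed
  have low: "q x \<le> p (x + s t y) - t * p y" if "0 \<le> t" for x t
    unfolding q_def using cINF_lower[OF bdd, of t x] that by simp
  have great: "c \<le> q x" if "\<And>t. 0 \<le> t \<Longrightarrow> c \<le> p (x + s t y) - t * p y" for c x
    unfolding q_def by (rule cINF_greatest) (use that in auto)
  have "q (x + z) \<le> q x + q z" for x z
  proof -
    have *: "q (x + z) \<le> (p (x + s t y) - t * p y) + (p (z + s u y) - u * p y)"
      if "0 \<le> t" "0 \<le> u" for t u
      using low[of "t + u" "x + z"] sublinear_add[OF p, of "x + s t y" "z + s u y"] that
      by (simp add: algebra_simps scale_left_distrib)
    have "q (x + z) - (p (z + s u y) - u * p y) \<le> q x" if "0 \<le> u" for u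
      by (rule great) (use *[OF _ that] in \<open>simp add: algebra_simps\<close>)
    then have "q (x + z) - q x \<le> q z"
      by (intro great) (simp add: algebra_simps)
    then show ?thesis by simp
  qed
  moreover have scale_le: "q (s r x) \<le> r * q x" if "0 < r" for r x
  proof -
    have "q (s r x) / r \<le> q x"
    proof (rule great)
      fix t :: real assume "0 \<le> t"
      then show "q (s r x) / r \<le> p (x + s t y) - t * p y"
        using low[of "r * t" "s r x"] sublinear_scale[OF p that, of "x + s t y"] that
        by (simp add: field_simps scale_right_distrib)
    qed
    then show ?thesis using that by (simp add: field_simps)
  qed
  moreover have "r * q x \<le> q (s r x)" if "0 < r" for r x
    using scale_le[of "1 / r" "s r x"] that by (simp add: field_simps)
  ultimately show "sublinear s q"
    unfolding sublinear_def by (meson antisym)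
  show "q \<le> p"
    using low[of 0] by (auto simp: le_fun_def)
  show "q (- y) \<le> - p y"
    using low[of 1 "- y"] sublinear_0[OF p] by simp
qed

text \<open>A pointwise minimal sublinear functional is odd, as otherwise the preceding lemma would
  produce a smaller one, and an odd sublinear functional is linear. So Zorn's lemma can be applied to
  functionals on the whole space, without partially defined extensions.\<close>

lemma hahn_banach:
  assumes p: "sublinear s p"
  obtains f where "Vector_Spaces.linear s (*) f" "f \<le> p" "f x0 = p x0"
proof -
  \<comment> \<open>Minimizing below \<open>p0\<close> instead of \<open>p\<close> secures the value
    at \<open>x0\<close>: the minimal \<open>f\<close> has \<open>f (- x0) \<le> - p x0\<close>, and
    oddness turns this into \<open>p x0 \<le> f x0\<close>.\<close>
  obtain p0 where p0: "sublinear s p0" "p0 \<le> p" "p0 (- x0) \<le> - p x0"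
    using sublinear_lower[OF p] by blast
  let ?A = "{q. sublinear s q \<and> q \<le> p0}"
  \<comment> \<open>The order is reversed, so that the maximal element from Zorn's lemma is a
    pointwise minimal functional.\<close>
  let ?R = "\<lambda>q r::'a \<Rightarrow> real. r \<le> q"
  have "\<exists>f\<in>?A. \<forall>q\<in>?A. q \<le> f \<longrightarrow> q = f"
  proof (rule predicate_Zorn)
    show "partial_order_on ?A (relation_of ?R ?A)"
      by (rule partial_order_on_relation_ofI) auto
    fix C assume C: "C \<in> Chains (relation_of ?R ?A)"
    show "\<exists>u\<in>?A. \<forall>q\<in>C. u \<le> q"
    proof (cases "C = {}")
      case True
      then show ?thesis using p0 by auto
    next
      case False
      have CA: "q \<in> ?A" if "q \<in> C" for q
        using C that by (auto simp: Chains_def relation_of_def)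
      have bdd: "bdd_below ((\<lambda>q. q x) ` C)" for x
      proof (rule bdd_belowI2)
        fix q assume "q \<in> C"
        with CA have "sublinear s q" "q (- x) \<le> p0 (- x)" by (auto simp: le_fun_def)
        then show "- p0 (- x) \<le> q x" using sublinear_minus[of q x] by linarith
      qed
      have "sublinear s (\<lambda>x. INF q\<in>C. q x)"
        by (rule sublinear_INF_chain[OF False _ _ bdd])
          (use C in \<open>auto simp: Chains_def relation_of_def\<close>)
      moreover have low: "(\<lambda>x. INF q\<in>C. q x) \<le> q" if "q \<in> C" for q
        using cINF_lower[OF bdd that] by (auto simp: le_fun_def)
      moreover have "(\<lambda>x. INF q\<in>C. q x) \<le> p0"
        using False low CA by (auto intro: order_trans)
      ultimately show ?thesis by blast
    qed
  qed
  then obtain f where f: "sublinear s f" "f \<le> p0"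
    and min: "\<And>q. sublinear s q \<Longrightarrow> q \<le> p0 \<Longrightarrow> q \<le> f \<Longrightarrow> q = f"
    by blast
  have neg: "f (- y) = - f y" for y
  proof -
    obtain q where "sublinear s q" "q \<le> f" "q (- y) \<le> - f y"
      using sublinear_lower[OF f(1)] by blast
    then have "f (- y) \<le> - f y"
      using min[of q] f(2) by (metis order_trans)
    then show ?thesis
      using sublinear_minus[OF f(1), of "- y"] by simp
  qed
  have add: "f (x + y) = f x + f y" for x y
    using sublinear_add[OF f(1), of x y] sublinear_add[OF f(1), of "x + y" "- y"] neg[of y] by simp
  have scale: "f (s r x) = r * f x" for r x
  proof -
    consider "0 < r" | "r = 0" | "0 < - r" by linarith
    then show ?thesis
    proof cases
      case 3
      then show ?thesis
        using sublinear_scale[OF f(1) 3, of x] neg[of "s r x"] by (simp add: scale_minus_left)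
    qed (use sublinear_scale[OF f(1)] sublinear_0[OF f(1)] in auto)
  qed
  have "vector_space ((*) :: real \<Rightarrow> real \<Rightarrow> real)"
    by unfold_locales (auto simp: algebra_simps)
  then have "Vector_Spaces.linear s (*) f"
    using add scale vector_space_axioms by (simp add: Vector_Spaces.linear_iff)
  moreover have fp: "f \<le> p"
    using f(2) p0(2) by (rule order_trans)
  moreover have "f x0 = p x0"
  proof (rule antisym)
    show "f x0 \<le> p x0" using fp by (simp add: le_fun_def)
    have "f (- x0) \<le> p0 (- x0)" using f(2) by (simp add: le_fun_def)
    then show "p x0 \<le> f x0" using p0(3) neg[of x0] by linarith
  qed
  ultimately show ?thesis by (rule that)
qed

section \<open>Gauges of convex absorbing sets\<close>

text \<open>The functional is the infimum of all \<open>t > 0\<close> with \<open>x / t\<close> in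
  \<open>V\<close>. Convexity of \<open>V\<close> yields subadditivity.\<close>

lemma minkowski_functional:
  assumes V0: "0 \<in> V"
    and convex: "\<And>x y t. x \<in> V \<Longrightarrow> y \<in> V \<Longrightarrow> 0 \<le> t \<Longrightarrow> t \<le> 1 \<Longrightarrow> s (1 - t) x + s t y \<in> V"
    and absorbing: "\<And>x. \<exists>t>0. s (1 / t) x \<in> V"
  obtains p where "sublinear s p" "\<And>x. x \<in> V \<Longrightarrow> p x \<le> 1" "\<And>x. x \<notin> V \<Longrightarrow> 1 \<le> p x"
proof
  define S where "S x = {t. 0 < t \<and> s (1 / t) x \<in> V}" for x
  define p where "p x = Inf (S x)" for x
  have ne: "S x \<noteq> {}" for x
    using absorbing[of x] by (auto simp: S_def)
  have low: "p x \<le> t" if "t \<in> S x" for x t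
    unfolding p_def by (rule cInf_lower[OF that]) (auto simp: S_def intro: bdd_belowI[of _ 0])
  have great: "c \<le> p x" if "\<And>t. t \<in> S x \<Longrightarrow> c \<le> t" for c x
    unfolding p_def by (rule cInf_greatest[OF ne that])
  have S_add: "t + u \<in> S (x + y)" if t: "t \<in> S x" and u: "u \<in> S y" for t u x y
  proof -
    have pos: "0 < t" "0 < u" using t u by (auto simp: S_def)
    \<comment> \<open>The point \<open>(x + y) / (t + u)\<close> is the convex combination of
      \<open>x / t\<close> and \<open>y / u\<close> with weights \<open>t / (t + u)\<close> and
      \<open>u / (t + u)\<close>.\<close>
    have "s (1 - u / (t + u)) (s (1 / t) x) + s (u / (t + u)) (s (1 / u) y) \<in> V"
      by (rule convex) (use t u pos in \<open>auto simp: S_def\<close>)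
    moreover have "(1 - u / (t + u)) * (1 / t) = 1 / (t + u)" "(u / (t + u)) * (1 / u) = 1 / (t + u)"
      using pos by (auto simp: field_simps)
    ultimately show ?thesis
      using pos by (simp add: S_def scale_right_distrib)
  qed
  have add: "p (x + y) \<le> p x + p y" for x y
  proof -
    have "p (x + y) - u \<le> p x" if "u \<in> S y" for u
      by (rule great) (use low[OF S_add[OF _ that]] in \<open>simp add: algebra_simps\<close>)
    then have "p (x + y) - p x \<le> p y"
      by (intro great) (simp add: algebra_simps)
    then show ?thesis by simp
  qed
  have S_scale: "r * t \<in> S (s r x)" if "0 < r" "t \<in> S x" for r t x
    using that by (simp add: S_def)
  have scale_le: "p (s r x) \<le> r * p x" if "0 < r" for r x
  proof -
    have "p (s r x) / r \<le> p x"
      by (rule great) (use low[OF S_scale[OF that]] that in \<open>simp add: field_simps\<close>)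
    then show ?thesis using that by (simp add: field_simps)
  qed
  moreover have "r * p x \<le> p (s r x)" if "0 < r" for r x
    using scale_le[of "1 / r" "s r x"] that by (simp add: field_simps)
  ultimately show "sublinear s p"
    unfolding sublinear_def using add by (meson antisym)
  show "p x \<le> 1" if "x \<in> V" for x
    by (rule low) (use that in \<open>simp add: S_def\<close>)
  show "1 \<le> p x" if "x \<notin> V" for x
  proof (rule great, rule ccontr)
    fix t assume t: "t \<in> S x" "\<not> 1 \<le> t"
    \<comment> \<open>For \<open>t < 1\<close> the point \<open>x\<close> lies on the segment from 0
      to \<open>x / t\<close>, hence in \<open>V\<close>.\<close>
    then have "s (1 - t) 0 + s t (s (1 / t) x) \<in> V"
      by (intro convex) (use V0 in \<open>auto simp: S_def\<close>)
    then show False using t that by (simp add: S_def)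
  qed
qed

end


subsection \<open>The dual of a locally convex Hausdorff space\<close>

lemma vector_space_mult: "vector_space ((*) :: 'k::field \<Rightarrow> 'k \<Rightarrow> 'k)"
  by unfold_locales (auto simp: algebra_simps)

lemma dual_iff:
  assumes "vector_space s"
  shows "g \<in> dual s \<longleftrightarrow>
    (\<forall>x y. g (x + y) = g x + g y) \<and> (\<forall>c x. g (s c x) = c * g x) \<and> continuous_on UNIV g"
  using assms vector_space_mult by (auto simp: dual_def Vector_Spaces.linear_iff)

context locally_convex_hausdorff_space
begin

lemma continuous_on_scale_right: "continuous_on UNIV (scale c)"
  by (rule continuous_on_compose2[OF continuous_scale, of UNIV "\<lambda>x. (c, x)", simplified])
    (auto intro: continuous_intros)

lemma continuous_on_scale_of_real: "continuous_on UNIV (\<lambda>r. scale (of_real r) x)"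
  by (rule continuous_on_compose2[OF continuous_scale, of UNIV "\<lambda>r. (of_real r, x)", simplified])
    (auto intro!: continuous_intros)

lemma real_scalar_space: "real_scalar_space (\<lambda>r. scale (of_real r))"
  by unfold_locales (auto simp: scale_right_distrib scale_left_distrib)

text \<open>A convex neighbourhood \<open>V\<close> of 0 that misses \<open>x0\<close> has a gauge
  \<open>p\<close> with \<open>p x0 \<ge> 1\<close>. The Hahn-Banach theorem gives a real-linear
  \<open>f \<le> p\<close> attaining \<open>p x0\<close> at \<open>x0\<close>, and
  \<open>f \<le> 1\<close> on \<open>V\<close> makes \<open>f\<close> continuous.\<close>

lemma real_functional_separates:
  assumes "x0 \<noteq> 0"
  obtains f :: "'a \<Rightarrow> real" where "\<And>x y. f (x + y) = f x + f y"
    "\<And>r x. f (scale (of_real r) x) = r * f x" "continuous_on UNIV f" "f x0 \<noteq> 0"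
proof -
  interpret R: real_scalar_space "\<lambda>r. scale (of_real r)" by (rule real_scalar_space)
  have "open (- {x0})" "0 \<in> - {x0}" using assms by auto
  then obtain V where V: "open V" "0 \<in> V" "V \<subseteq> - {x0}"
    and convex: "\<forall>x\<in>V. \<forall>y\<in>V. \<forall>t\<in>{0..1}. scale (of_real (1 - t)) x + scale (of_real t) y \<in> V"
    using locally_convex by meson
  \<comment> \<open>As \<open>r\<close> tends to 0, \<open>r x\<close> tends to 0 and so enters
    \<open>V\<close>.\<close>
  have absorbing: "\<exists>t>0. scale (of_real (1 / t)) x \<in> V" for x
  proof -
    have "open ((\<lambda>r. scale (of_real r) x) -` V)"
      using V(1) continuous_on_scale_of_real by (rule open_vimage)
    moreover have "(0::real) \<in> (\<lambda>r. scale (of_real r) x) -` V"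
      using V(2) by simp
    ultimately obtain e where e: "0 < e" "ball 0 e \<subseteq> (\<lambda>r. scale (of_real r) x) -` V"
      by (meson openE)
    then have "e / 2 \<in> (\<lambda>r. scale (of_real r) x) -` V"
      by (intro subsetD[OF e(2)]) (simp add: dist_norm)
    then show ?thesis
      using e(1) by (intro exI[of _ "2 / e"]) simp
  qed
  obtain p where p: "sublinear (\<lambda>r. scale (of_real r)) p" "\<And>x. x \<in> V \<Longrightarrow> p x \<le> 1"
    "\<And>x. x \<notin> V \<Longrightarrow> 1 \<le> p x"
    using R.minkowski_functional[of V] V(2) convex absorbing by (metis atLeastAtMost_iff)
  obtain f where f: "Vector_Spaces.linear (\<lambda>r. scale (of_real r)) (*) f" "f \<le> p" "f x0 = p x0"
    using R.hahn_banach[OF p(1)] by blast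
  have add: "f (x + y) = f x + f y" and sc: "f (scale (of_real r) x) = r * f x" for x y r
    using f(1) R.vector_space_axioms vector_space_mult by (simp_all add: Vector_Spaces.linear_iff)
  have diff: "f (x - y) = f x - f y" for x y
    using add[of "x - y" y] by simp
  have V1: "f x \<le> 1" if "x \<in> V" for x
    using f(2) p(2)[OF that] by (auto simp: le_fun_def intro: order_trans)
  have "continuous_on UNIV f"
    unfolding continuous_on_def
  proof (intro ballI tendstoI)
    fix x and e :: real assume "0 < e"
    \<comment> \<open>The factor \<open>2 / e\<close> turns the bound 1 on \<open>V\<close> into
      \<open>e / 2 < e\<close>. Since \<open>V\<close> need not be symmetric, both signs of the
      difference are put into \<open>?U\<close>.\<close>
    let ?c = "of_real (2 / e) :: 'k"
    let ?U = "(\<lambda>y. scale ?c (y - x)) -` V \<inter> (\<lambda>y. scale ?c (x - y)) -` V"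
    have "open ?U"
      by (intro open_Int open_vimage[OF V(1)] continuous_on_compose2[OF continuous_on_scale_right]
          continuous_intros) auto
    moreover have "x \<in> ?U" using V(2) by simp
    moreover have "dist (f y) (f x) < e" if "y \<in> ?U" for y
    proof -
      have "2 / e * (f y - f x) \<le> 1" "2 / e * (f x - f y) \<le> 1"
        using that V1[of "scale ?c (y - x)"] V1[of "scale ?c (x - y)"] by (auto simp: sc diff simp del: of_real_divide)
      then show ?thesis using \<open>0 < e\<close> by (auto simp: dist_real_def field_simps abs_if)
    qed
    ultimately show "\<forall>\<^sub>F y in at x within UNIV. dist (f y) (f x) < e"
      by (auto simp: eventually_at_topological)
  qed
  moreover have "f x0 \<noteq> 0"
    using p(3)[of x0] V(3) f(3) by auto
  ultimately show ?thesis
    using add sc by (intro that)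
qed

text \<open>Both scalar fields are treated at once. As 1 and \<open>i\<close> span \<open>'k\<close>
  over the reals, homogeneity of \<open>g\<close> has to be checked only for real factors and for
  \<open>i\<close>.\<close>

lemma dual_separates:
  assumes "x0 \<noteq> 0"
  shows "\<exists>g\<in>dual scale. g x0 \<noteq> 0"
proof -
  obtain f :: "'a \<Rightarrow> real" where add: "\<And>x y. f (x + y) = f x + f y"
    and sc: "\<And>r x. f (scale (of_real r) x) = r * f x"
    and cont: "continuous_on UNIV f" and f0: "f x0 \<noteq> 0"
    using real_functional_separates[OF assms] by blast
  obtain i :: 'k where i: "i = 0 \<or> i * i = - 1"
    and span: "\<And>z. \<exists>a b. z = of_real a + of_real b * i"
    using real_or_complex by (metis of_real_def scaleR_conv_of_real)
  text \<open>The usual complexification of a real functional; it degenerates to \<open>f\<close> when \<open>i = 0\<close>.\<close>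
  define g where "g x = of_real (f x) - i * of_real (f (scale i x))" for x
  have f_0: "f 0 = 0" using add[of 0 0] by simp
  have f_minus: "f (- x) = - f x" for x
    using add[of x "- x"] f_0 by simp
  have g_add: "g (x + y) = g x + g y" for x y
    by (simp add: g_def add scale_right_distrib algebra_simps)
  have g_real: "g (scale (of_real r) x) = of_real r * g x" for r x
    using sc[of r "scale i x"] by (simp add: g_def sc algebra_simps)
  have g_i: "g (scale i x) = i * g x" for x
    using i
  proof
    assume ii: "i * i = - 1"
    then have "i * (i * z) = - z" for z
      by (metis mult.assoc mult_minus1)
    then show ?thesis
      using ii by (simp add: g_def f_minus right_diff_distrib)
  qed (simp add: g_def f_0)
  have "g (scale c x) = c * g x" for c x
  proof -
    obtain a b where c: "c = of_real a + of_real b * i" using span by blast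
    have "g (scale c x) = g (scale (of_real a) x) + g (scale (of_real b) (scale i x))"
      by (simp add: c scale_left_distrib g_add)
    then show ?thesis by (simp only: g_real g_i c distrib_right mult.assoc)
  qed
  moreover have "continuous_on UNIV g"
    unfolding g_def
    by (intro continuous_intros cont continuous_on_compose2[OF cont continuous_on_scale_right]) auto
  moreover have "g x0 \<noteq> 0"
    using i
  proof
    assume ii: "i * i = - 1"
    show ?thesis
    proof
      assume "g x0 = 0"
      then have "of_real (f x0) = i * of_real (f (scale i x0))" by (simp add: g_def)
      \<comment> \<open>The field \<open>'k\<close> is abstract, so real parts are not compared;
        squaring instead replaces \<open>i\<close> by \<open>- 1\<close> and leaves a vanishing sum
        of two real squares.\<close>
      then have "of_real (f x0) * of_real (f x0) = (i * i) * (of_real (f (scale i x0)) * of_real (f (scale i x0)))"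
        by (simp add: algebra_simps)
      then have "of_real (f x0 * f x0 + f (scale i x0) * f (scale i x0)) = (0 :: 'k)"
        by (simp add: ii)
      then show False
        using f0 by (simp only: of_real_eq_0_iff sum_squares_eq_zero_iff simp_thms)
    qed
  qed (use f0 in \<open>simp add: g_def\<close>)
  ultimately show ?thesis
    using g_add dual_iff[OF vector_space_axioms] by blast
qed

end

section \<open>Continuity of evaluations and vector operations in the weak-$*$ topology\<close>

lemma continuous_map_weak_star_apply: "continuous_map (weak_star s) euclidean (\<lambda>g. g x)"
  unfolding weak_star_def
  by (intro continuous_map_from_subtopology continuous_map_product_projection) simp

text \<open>The weak-$*$ topology is the initial topology for the evaluations, so continuity can be
  tested pointwise.\<close>

lemma continuous_map_into_weak_star:
  assumes "\<And>z. z \<in> topspace Z \<Longrightarrow> F z \<in> dual s" "\<And>x. continuous_map Z euclidean (\<lambda>z. F z x)"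
  shows "continuous_map Z (weak_star s) F"
  unfolding weak_star_def
  using assms by (auto simp: continuous_map_in_subtopology continuous_map_componentwise_UNIV)

lemma module_fun_scale: "module (fun_scale :: 'k::field \<Rightarrow> ('a \<Rightarrow> 'k) \<Rightarrow> _)"
  by unfold_locales (auto simp: fun_scale_def algebra_simps)

lemma dual_0: "vector_space s \<Longrightarrow> 0 \<in> dual s"
  by (simp add: dual_iff)

lemma dual_add: "vector_space s \<Longrightarrow> g \<in> dual s \<Longrightarrow> h \<in> dual s \<Longrightarrow> g + h \<in> dual s"
  by (auto simp: dual_iff algebra_simps plus_fun_def intro: continuous_intros)

lemma dual_fun_scale: "vector_space s \<Longrightarrow> g \<in> dual s \<Longrightarrow> fun_scale c g \<in> dual s"
  by (auto simp: dual_iff algebra_simps fun_scale_def intro: continuous_intros)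

lemma continuous_map_weak_star_add:
  assumes "vector_space s"
  shows "continuous_map (prod_topology (weak_star s) (weak_star s)) (weak_star s) (\<lambda>(g, h). g + h)"
proof (rule continuous_map_into_weak_star)
  fix x
  show "continuous_map (prod_topology (weak_star s) (weak_star s)) euclidean
      (\<lambda>z. (case z of (g, h) \<Rightarrow> g + h) x)"
    unfolding split_def plus_fun_apply
    by (intro continuous_map_add
        continuous_map_compose[OF continuous_map_fst continuous_map_weak_star_apply, unfolded comp_def]
        continuous_map_compose[OF continuous_map_snd continuous_map_weak_star_apply, unfolded comp_def])
qed (use assms in \<open>auto intro: dual_add\<close>)

lemma continuous_map_weak_star_fun_scale:
  assumes "vector_space s"
  shows "continuous_map (weak_star s) (weak_star s) (fun_scale c)"
proof (rule continuous_map_into_weak_star)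
  fix x
  have "continuous_map euclidean euclidean (\<lambda>z. c * z)"
    by (auto intro: continuous_intros)
  from continuous_map_compose[OF continuous_map_weak_star_apply this]
  show "continuous_map (weak_star s) euclidean (\<lambda>g. fun_scale c g x)"
    by (simp add: fun_scale_def comp_def)
qed (use assms in \<open>auto intro: dual_fun_scale\<close>)

section \<open>The dual of a product\<close>

lemma join_dual_in_dual:
  assumes "vector_space sX" "vector_space sY" "g \<in> dual sX" "h \<in> dual sY"
  shows "join_dual (g, h) \<in> dual (prod_scale sX sY)"
  using homeomorphic_maps_join_split_dual[OF assms(1,2)] assms(3,4)
  by (auto simp: homeomorphic_maps_def continuous_map_def)

lemma split_dual_join_dual:
  assumes "vector_space sX" "vector_space sY" "g \<in> dual sX" "h \<in> dual sY"
  shows "split_dual (join_dual (g, h)) = (g, h)"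
  using homeomorphic_maps_join_split_dual[OF assms(1,2)] assms(3,4)
  by (auto simp: homeomorphic_maps_def)

text \<open>Some component of \<open>z\<close> is nonzero; a functional separating it from 0 is
  extended by zero to the other summand.\<close>

lemma dual_prod_separates:
  assumes "locally_convex_hausdorff_space sX" "locally_convex_hausdorff_space sY" "z \<noteq> 0"
  shows "\<exists>g\<in>dual (prod_scale sX sY). g z \<noteq> 0"
proof -
  interpret X: locally_convex_hausdorff_space sX by fact
  interpret Y: locally_convex_hausdorff_space sY by fact
  note vs = X.vector_space_axioms Y.vector_space_axioms
  from assms(3) consider "fst z \<noteq> 0" | "snd z \<noteq> 0"
    by (auto simp: prod_eq_iff)
  then show ?thesis
  proof cases
    case 1
    then obtain g where "g \<in> dual sX" "g (fst z) \<noteq> 0" using X.dual_separates by blast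
    then show ?thesis
      using join_dual_in_dual[OF vs _ dual_0[OF vs(2)]]
      by (intro bexI[of _ "join_dual (g, 0)"]) (auto simp: join_dual_def split_def)
  next
    case 2
    then obtain g where "g \<in> dual sY" "g (snd z) \<noteq> 0" using Y.dual_separates by blast
    then show ?thesis
      using join_dual_in_dual[OF vs dual_0[OF vs(1)]]
      by (intro bexI[of _ "join_dual (0, g)"]) (auto simp: join_dual_def split_def)
  qed
qed


subsection \<open>Linear operators, adjoints and closability\<close>

lemma linear_operator_iff:
  assumes "module sX"
  shows "linear_operator sX X sY Y T \<longleftrightarrow>
    0 \<in> dmn T \<and> (\<forall>x\<in>dmn T. \<forall>y\<in>dmn T. x + y \<in> dmn T) \<and> (\<forall>c. \<forall>x\<in>dmn T. sX c x \<in> dmn T) \<and>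
    dmn T \<subseteq> topspace X \<and> app T ` dmn T \<subseteq> topspace Y \<and>
    (\<forall>x\<in>dmn T. \<forall>y\<in>dmn T. app T (x + y) = app T x + app T y) \<and>
    (\<forall>c. \<forall>x\<in>dmn T. app T (sX c x) = sY c (app T x))"
  unfolding linear_operator_def module.subspace_def[OF assms] by blast

text \<open>A restriction inherits linearity once its domain is a subspace. This reduces linearity
  of the formal adjoint to that of the adjoint.\<close>

lemma linear_operator_op_le:
  assumes X: "module sX" and T: "linear_operator sX X sY Y T" and le: "op_le S T"
    and S: "0 \<in> dmn S" "\<And>x y. x \<in> dmn S \<Longrightarrow> y \<in> dmn S \<Longrightarrow> x + y \<in> dmn S"
      "\<And>c x. x \<in> dmn S \<Longrightarrow> sX c x \<in> dmn S"
  shows "linear_operator sX X sY Y S"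
  using assms unfolding linear_operator_iff[OF X] op_le_def by (auto simp: subset_iff image_subset_iff)

lemma op_graph_iff: "(x, y) \<in> op_graph T \<longleftrightarrow> x \<in> dmn T \<and> y = app T x"
  by (auto simp: op_graph_def)

text \<open>By continuity of the vector operations the closure of the graph is again a linear
  subspace, so being single-valued makes it the graph of a linear operator. Topologies are
  parameters because the lemma serves both the given spaces and their weak-$*$ duals.\<close>

lemma closable_if_closure_single_valued:
  assumes mX: "module sX" and T: "linear_operator sX X sY Y T"
    and addX: "continuous_map (prod_topology X X) X (\<lambda>(x, y). x + y)"
    and addY: "continuous_map (prod_topology Y Y) Y (\<lambda>(x, y). x + y)"
    and scaleX: "\<And>c. continuous_map X X (sX c)"
    and scaleY: "\<And>c. continuous_map Y Y (sY c)"
    and sv: "\<And>x y y'. (x, y) \<in> prod_topology X Y closure_of op_graph T \<Longrightarrow>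
      (x, y') \<in> prod_topology X Y closure_of op_graph T \<Longrightarrow> y = y'"
  shows "closable sX X sY Y T"
proof -
  define Z where "Z = prod_topology X Y"
  define C where "C = Z closure_of op_graph T"
  note T = T[unfolded linear_operator_iff[OF mX]]
  have graph_top: "op_graph T \<subseteq> topspace Z"
    using T by (auto simp: Z_def op_graph_iff)
  have C_top: "C \<subseteq> topspace Z"
    by (simp add: C_def closure_of_subset_topspace)
  have graph_C: "op_graph T \<subseteq> C"
    unfolding C_def by (rule closure_of_subset[OF graph_top])
  have contA: "continuous_map (prod_topology Z Z) Z (\<lambda>(u, v). (fst u + fst v, snd u + snd v))"
  proof -
    have "continuous_map (prod_topology Z Z) (prod_topology X X) (\<lambda>w. (fst (fst w), fst (snd w)))"
      "continuous_map (prod_topology Z Z) (prod_topology Y Y) (\<lambda>w. (snd (fst w), snd (snd w)))"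
      unfolding Z_def continuous_map_pairwise comp_def
      by (auto intro: continuous_map_compose[unfolded comp_def] continuous_map_fst continuous_map_snd)
    from continuous_map_compose[OF this(1) addX] continuous_map_compose[OF this(2) addY]
    show ?thesis
      by (simp add: Z_def[symmetric] continuous_map_pairwise comp_def split_def)
        (simp add: Z_def continuous_map_pairwise comp_def split_def)
  qed
  have contS: "continuous_map Z Z (\<lambda>u. (sX c (fst u), sY c (snd u)))" for c
    unfolding Z_def continuous_map_pairwise comp_def
    using continuous_map_compose[OF continuous_map_fst scaleX]
      continuous_map_compose[OF continuous_map_snd scaleY]
    by (auto simp: comp_def)
  have C_add: "(x + x', y + y') \<in> C" if "(x, y) \<in> C" "(x', y') \<in> C" for x x' y y'
  proof -
    \<comment> \<open>The closure of a product is the product of the closures, so the continuous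
      addition can be applied to both points at once.\<close>
    have "((x, y), (x', y')) \<in> prod_topology Z Z closure_of (op_graph T \<times> op_graph T)"
      using that by (simp add: closure_of_Times C_def)
    then have "(x + x', y + y') \<in>
        Z closure_of ((\<lambda>(u, v). (fst u + fst v, snd u + snd v)) ` (op_graph T \<times> op_graph T))"
      using continuous_map_image_closure_subset[OF contA, of "op_graph T \<times> op_graph T"] by force
    moreover have "(\<lambda>(u, v). (fst u + fst v, snd u + snd v)) ` (op_graph T \<times> op_graph T) \<subseteq> op_graph T"
      using T by (auto simp: op_graph_iff)
    ultimately show ?thesis
      unfolding C_def using closure_of_mono by blast
  qed
  have C_scale: "(sX c x, sY c y) \<in> C" if "(x, y) \<in> C" for c x y
  proof -
    have "(sX c x, sY c y) \<in> Z closure_of ((\<lambda>u. (sX c (fst u), sY c (snd u))) ` op_graph T)"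
      using continuous_map_image_closure_subset[OF contS[of c], of "op_graph T"] that
      by (force simp: C_def)
    moreover have "(\<lambda>u. (sX c (fst u), sY c (snd u))) ` op_graph T \<subseteq> op_graph T"
      using T by (auto simp: op_graph_iff)
    ultimately show ?thesis
      unfolding C_def using closure_of_mono by blast
  qed
  \<comment> \<open>Single-valuedness of \<open>C\<close> is what makes the \<open>THE\<close> well
    defined.\<close>
  define S where "S = Operator (fst ` C) (\<lambda>x. THE y. (x, y) \<in> C)"
  have app_S: "app S x = y" if "(x, y) \<in> C" for x y
    unfolding S_def using that sv unfolding C_def Z_def by (auto intro!: the_equality)
  have dmn_S: "x \<in> dmn S \<longleftrightarrow> (\<exists>y. (x, y) \<in> C)" for x
    by (force simp: S_def)
  have "op_graph S = C"
    using app_S by (auto simp: op_graph_iff dmn_S)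
  moreover have "linear_operator sX X sY Y S"
    unfolding linear_operator_iff[OF mX]
  proof (intro conjI ballI allI subsetI)
    have "(0, app T 0) \<in> C"
      using T graph_C by (auto simp: op_graph_iff)
    then show "0 \<in> dmn S" by (auto simp: dmn_S)
  next
    fix x y assume "x \<in> dmn S" "y \<in> dmn S"
    then obtain x' y' where *: "(x, x') \<in> C" "(y, y') \<in> C" by (auto simp: dmn_S)
    then show "x + y \<in> dmn S" "app S (x + y) = app S x + app S y"
      using C_add[OF *] by (auto simp: dmn_S app_S)
  next
    fix c x assume "x \<in> dmn S"
    then obtain x' where *: "(x, x') \<in> C" by (auto simp: dmn_S)
    then show "sX c x \<in> dmn S" "app S (sX c x) = sY c (app S x)"
      using C_scale[OF *, of c] by (auto simp: dmn_S app_S)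
  next
    fix x assume "x \<in> dmn S"
    then show "x \<in> topspace X" using C_top by (auto simp: dmn_S Z_def)
  next
    fix y assume "y \<in> app S ` dmn S"
    then show "y \<in> topspace Y" using C_top by (fastforce simp: dmn_S Z_def app_S)
  qed
  ultimately show ?thesis
    unfolding closable_def C_def Z_def by blast
qed

section \<open>Uniqueness, linearity and closedness of the adjoint\<close>

text \<open>Two continuous functionals agree on a closed set. This gives the uniqueness behind the
  \<open>THE\<close> in \<open>op_adjoint\<close>.\<close>

lemma dual_eq_on_dense:
  assumes "closure D = UNIV" "g \<in> dual s" "h \<in> dual s" "\<And>x. x \<in> D \<Longrightarrow> g x = h x"
  shows "g = h"
proof -
  have "closed {x. g x = h x}"
    using assms(2,3) by (intro closed_Collect_eq) (auto simp: dual_def)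
  then have "closure D \<subseteq> {x. g x = h x}"
    by (intro closure_minimal) (use assms(4) in auto)
  then show ?thesis using assms(1) by auto
qed

lemma op_adjoint_eqI:
  assumes "closure (dmn T) = UNIV" "g \<in> dual sY" "h \<in> dual sX" "\<And>f. f \<in> dmn T \<Longrightarrow> g (app T f) = h f"
  shows "g \<in> dmn (op_adjoint sX sY T)" "app (op_adjoint sX sY T) g = h"
proof -
  show "g \<in> dmn (op_adjoint sX sY T)"
    using assms by (auto simp: op_adjoint_def)
  show "app (op_adjoint sX sY T) g = h"
    unfolding op_adjoint_def operator.sel
    by (rule the_equality) (use assms in \<open>auto intro: dual_eq_on_dense[OF assms(1)]\<close>)
qed

lemma op_adjointD:
  assumes "closure (dmn T) = UNIV" "g \<in> dmn (op_adjoint sX sY T)"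
  shows "g \<in> dual sY" "app (op_adjoint sX sY T) g \<in> dual sX"
    "f \<in> dmn T \<Longrightarrow> g (app T f) = app (op_adjoint sX sY T) g f"
proof -
  obtain h where "g \<in> dual sY" "h \<in> dual sX" "\<forall>f\<in>dmn T. g (app T f) = h f"
    using assms(2) by (auto simp: op_adjoint_def)
  then show "g \<in> dual sY" "app (op_adjoint sX sY T) g \<in> dual sX"
    "f \<in> dmn T \<Longrightarrow> g (app T f) = app (op_adjoint sX sY T) g f"
    using op_adjoint_eqI[OF assms(1), of g sY h sX] by auto
qed

lemma linear_operator_op_adjoint:
  assumes X: "vector_space sX" and Y: "vector_space sY" and T: "closure (dmn T) = UNIV"
  shows "linear_operator fun_scale (weak_star sY) fun_scale (weak_star sX) (op_adjoint sX sY T)"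
proof -
  let ?T' = "op_adjoint sX sY T"
  note D = op_adjointD[OF T, of _ sX sY]
  have "g + h \<in> dmn ?T' \<and> app ?T' (g + h) = app ?T' g + app ?T' h"
    if g: "g \<in> dmn ?T'" and h: "h \<in> dmn ?T'" for g h
  proof -
    have "(g + h) (app T f) = (app ?T' g + app ?T' h) f" if "f \<in> dmn T" for f
      using D(3)[OF g that] D(3)[OF h that] by simp
    then show ?thesis
      using op_adjoint_eqI[OF T dual_add[OF Y D(1)[OF g] D(1)[OF h]] dual_add[OF X D(2)[OF g] D(2)[OF h]]]
      by blast
  qed
  moreover have "fun_scale c g \<in> dmn ?T' \<and> app ?T' (fun_scale c g) = fun_scale c (app ?T' g)"
    if g: "g \<in> dmn ?T'" for c g
  proof -
    have "fun_scale c g (app T f) = fun_scale c (app ?T' g) f" if "f \<in> dmn T" for f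
      using D(3)[OF g that] by (simp add: fun_scale_def)
    then show ?thesis
      using op_adjoint_eqI[OF T dual_fun_scale[OF Y D(1)[OF g]] dual_fun_scale[OF X D(2)[OF g]]]
      by blast
  qed
  moreover have "0 \<in> dmn ?T'"
    by (rule op_adjoint_eqI(1)[OF T dual_0[OF Y] dual_0[OF X]]) simp
  ultimately show ?thesis
    using D by (auto simp: linear_operator_iff[OF module_fun_scale])
qed

text \<open>For fixed \<open>f\<close> the equation \<open>g (T f) = h f\<close> compares two
  evaluations that are weak-$*$ continuous in \<open>(g, h)\<close>, so it persists in the closure;
  density of the domain of \<open>T\<close> then identifies \<open>h\<close>.\<close>

lemma closure_graph_op_adjoint:
  assumes T: "closure (dmn T) = UNIV"
    and gh: "(g, h) \<in> prod_topology (weak_star sY) (weak_star sX) closure_of op_graph (op_adjoint sX sY T)"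
  shows "app (op_adjoint sX sY T) g = h"
proof (rule op_adjoint_eqI(2)[OF T])
  let ?Z = "prod_topology (weak_star sY) (weak_star sX)"
  have top: "(g, h) \<in> topspace ?Z"
    by (rule subsetD[OF closure_of_subset_topspace gh])
  then show "g \<in> dual sY" "h \<in> dual sX" by auto
  fix f assume f: "f \<in> dmn T"
  have "closedin ?Z {u \<in> topspace ?Z. fst u (app T f) = snd u f}"
    by (intro closedin_continuous_maps_eq[where Y = euclidean]
        continuous_map_compose[OF continuous_map_fst continuous_map_weak_star_apply, unfolded comp_def]
        continuous_map_compose[OF continuous_map_snd continuous_map_weak_star_apply, unfolded comp_def])
      simp
  then have "?Z closure_of op_graph (op_adjoint sX sY T) \<subseteq> {u \<in> topspace ?Z. fst u (app T f) = snd u f}"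
    by (intro closure_of_minimal) (auto simp: op_graph_iff f op_adjointD[OF T])
  then show "g (app T f) = h f" using gh by auto
qed

section \<open>Closability criteria in terms of the adjoint\<close>

text \<open>The closure of the graph of \<open>S\<close> lies in that of the adjoint, where the
  first component determines the second.\<close>

lemma closable_if_op_le_adjoint:
  assumes X: "vector_space sX" and Y: "vector_space sY" and T: "closure (dmn T) = UNIV"
    and S: "linear_operator fun_scale (weak_star sY) fun_scale (weak_star sX) S"
    and le: "op_le S (op_adjoint sX sY T)"
  shows "closable fun_scale (weak_star sY) fun_scale (weak_star sX) S"
proof -
  have "op_graph S \<subseteq> op_graph (op_adjoint sX sY T)"
    using le by (auto simp: op_le_def op_graph_iff)
  then have "app (op_adjoint sX sY T) g = h"
    if "(g, h) \<in> prod_topology (weak_star sY) (weak_star sX) closure_of op_graph S" for g h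
    using that closure_graph_op_adjoint[OF T] closure_of_mono by blast
  then show ?thesis
    by (intro closable_if_closure_single_valued module_fun_scale S
        continuous_map_weak_star_add continuous_map_weak_star_fun_scale X Y) blast
qed

text \<open>Taking equal values at \<open>x\<close> and \<open>y\<close> is a weak-$*$ closed
  condition on \<open>g\<close>.\<close>

lemma weak_star_dense_eq:
  assumes D: "weak_star s closure_of D = dual s" "D \<subseteq> dual s" and eq: "\<And>g. g \<in> D \<Longrightarrow> g x = g y"
    and g: "g \<in> dual s"
  shows "g x = g y"
proof -
  have "closedin (weak_star s) {g \<in> topspace (weak_star s). g x = g y}"
    by (intro closedin_continuous_maps_eq[where Y = euclidean] continuous_map_weak_star_apply) simp
  then have "weak_star s closure_of D \<subseteq> {g \<in> topspace (weak_star s). g x = g y}"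
    by (intro closure_of_minimal) (use D(2) eq in auto)
  then show ?thesis using D(1) g by auto
qed

text \<open>For \<open>g\<close> in the domain of \<open>S\<close>, both \<open>g\<close> and
  \<open>S g\<close> are continuous, so \<open>g y = (S g) x\<close> extends from the graph of
  \<open>T\<close> to its closure. Points of the closure over the same \<open>x\<close> are thus not
  separated by a weak-$*$ dense set of functionals, hence by none.\<close>

lemma closable_if_adjoint_dense:
  fixes T :: "('a::{ab_group_add, topological_space}, 'b::{ab_group_add, topological_space}) operator"
  assumes mX: "module sX" and Y: "vector_space sY"
    and T: "linear_operator sX euclidean sY euclidean T" "closure (dmn T) = UNIV"
    and addX: "continuous_map euclidean euclidean (\<lambda>(x, y). x + y :: 'a)"
    and addY: "continuous_map euclidean euclidean (\<lambda>(x, y). x + y :: 'b)"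
    and scaleX: "\<And>c. continuous_map euclidean euclidean (sX c)"
    and scaleY: "\<And>c. continuous_map euclidean euclidean (sY c)"
    and sep: "\<And>z. z \<noteq> 0 \<Longrightarrow> \<exists>g\<in>dual sY. g z \<noteq> 0"
    and le: "op_le S (op_adjoint sX sY T)" and S: "densely_defined (weak_star sY) S"
  shows "closable sX euclidean sY euclidean T"
proof -
  have val: "g y = app S g x"
    if xy: "(x, y) \<in> closure (op_graph T)" and g: "g \<in> dmn S" for x y g
  proof -
    have g': "g \<in> dmn (op_adjoint sX sY T)" and app: "app S g = app (op_adjoint sX sY T) g"
      using le g by (auto simp: op_le_def)
    have "closed {u. g (snd u) = app S g (fst u)}"
    proof (rule closed_Collect_eq)
      have "continuous_on UNIV g" "continuous_on UNIV (app S g)"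
        unfolding app using op_adjointD(1,2)[OF T(2) g'] by (auto simp: dual_def)
      then show "continuous_on UNIV (\<lambda>u. g (snd u))" "continuous_on UNIV (\<lambda>u. app S g (fst u))"
        by (auto intro: continuous_on_compose2[OF _ continuous_on_snd[OF continuous_on_id]]
            continuous_on_compose2[OF _ continuous_on_fst[OF continuous_on_id]])
    qed
    then have "closure (op_graph T) \<subseteq> {u. g (snd u) = app S g (fst u)}"
      by (intro closure_minimal) (auto simp: op_graph_iff app op_adjointD[OF T(2) g'])
    then show ?thesis using xy by auto
  qed
  have D: "weak_star sY closure_of dmn S = dual sY" "dmn S \<subseteq> dual sY"
    using S le op_adjointD(1)[OF T(2), of _ sX sY] by (auto simp: densely_defined_def op_le_def)
  have "y = y'" if "(x, y) \<in> closure (op_graph T)" "(x, y') \<in> closure (op_graph T)" for x y y'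
  proof (rule ccontr)
    assume "y \<noteq> y'"
    then obtain g where g: "g \<in> dual sY" "g (y - y') \<noteq> 0"
      using sep[of "y - y'"] by auto
    have "g (y - y') = g y - g y'"
      using g(1) Y by (metis add_diff_cancel_right' diff_add_cancel dual_iff)
    moreover have "g y = g y'"
      by (rule weak_star_dense_eq[OF D _ g(1)]) (use val[OF that(1)] val[OF that(2)] in simp)
    ultimately show False using g(2) by simp
  qed
  then show ?thesis
    using mX T(1) addX addY scaleX scaleY
    by (intro closable_if_closure_single_valued) simp_all
qed


subsection \<open>Operator matrices\<close>

lemma continuous_map_add_prod:
  "continuous_map euclidean euclidean
    (\<lambda>(x, y). x + y :: 'a::topological_ab_group_add \<times> 'b::topological_ab_group_add)"
  by (auto simp: split_def plus_prod_def intro!: continuous_intros)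

lemma continuous_map_prod_scale:
  assumes "locally_convex_hausdorff_space sX" "locally_convex_hausdorff_space sY"
  shows "continuous_map euclidean euclidean (prod_scale sX sY c)"
proof -
  interpret X: locally_convex_hausdorff_space sX by fact
  interpret Y: locally_convex_hausdorff_space sY by fact
  show ?thesis
    unfolding prod_scale_def split_def
    by (auto intro!: continuous_on_Pair continuous_intros
        continuous_on_compose2[OF X.continuous_on_scale_right]
        continuous_on_compose2[OF Y.continuous_on_scale_right])
qed

lemma linear_operator_op_matrix:
  fixes A11 :: "('a::{ab_group_add, topological_space}, 'c::{ab_group_add, topological_space}) operator"
    and A12 :: "('b::{ab_group_add, topological_space}, 'c) operator"
    and A21 :: "('a, 'd::{ab_group_add, topological_space}) operator"
    and A22 :: "('b, 'd) operator"
  assumes E: "vector_space sE1" "vector_space sE2" and F: "vector_space sF1" "vector_space sF2"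
    and A: "linear_operator sE1 euclidean sF1 euclidean A11" "linear_operator sE2 euclidean sF1 euclidean A12"
      "linear_operator sE1 euclidean sF2 euclidean A21" "linear_operator sE2 euclidean sF2 euclidean A22"
  shows "linear_operator (prod_scale sE1 sE2) euclidean (prod_scale sF1 sF2) euclidean
    (op_matrix A11 A12 A21 A22)"
proof -
  interpret F1: vector_space sF1 by fact
  interpret F2: vector_space sF2 by fact
  note E' = E[folded module_iff_vector_space]
  note E2 = vector_space_prod_scale[OF E, folded module_iff_vector_space]
  show ?thesis
    using A unfolding linear_operator_iff[OF E'(1)] linear_operator_iff[OF E'(2)] linear_operator_iff[OF E2]
    by (auto simp: op_matrix_def prod_scale_def zero_prod_def F1.scale_right_distrib F2.scale_right_distrib
        algebra_simps)
qed

text \<open>The inclusion regroups \<open>g1 (A11 f1 + A12 f2) + g2 (A21 f1 + A22 f2)\<close> by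
  \<open>f1\<close> and \<open>f2\<close>. Linearity is proved alongside, because it is obtained by
  restricting the adjoint along this inclusion.\<close>

lemma
  assumes E: "vector_space sE1" "vector_space sE2" and F: "vector_space sF1" "vector_space sF2"
    and D: "closure (dmn A11) = UNIV" "closure (dmn A12) = UNIV"
      "closure (dmn A21) = UNIV" "closure (dmn A22) = UNIV"
      "closure (dmn A11 \<inter> dmn A21) = UNIV" "closure (dmn A12 \<inter> dmn A22) = UNIV"
  shows formal_adjoint_op_le: "op_le (formal_adjoint sE1 sE2 sF1 sF2 A11 A12 A21 A22)
      (op_adjoint (prod_scale sE1 sE2) (prod_scale sF1 sF2) (op_matrix A11 A12 A21 A22))" (is "op_le ?Ax ?A'")
    and linear_operator_formal_adjoint:
      "linear_operator fun_scale (weak_star (prod_scale sF1 sF2)) fun_scale (weak_star (prod_scale sE1 sE2))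
        (formal_adjoint sE1 sE2 sF1 sF2 A11 A12 A21 A22)"
proof -
  let ?A = "op_matrix A11 A12 A21 A22"
  have A: "closure (dmn ?A) = UNIV"
    using D(5,6) by (simp add: op_matrix_def closure_Times)
  \<comment> \<open>Transposition: the first row of \<open>A\<close>, with values in
    \<open>F1\<close>, becomes the first column of \<open>A\<^sup>\<times>\<close>, acting on
    \<open>F1'\<close>; \<open>D2\<close> belongs to the second row in the same way.\<close>
  define D1 where "D1 = dmn (op_adjoint sE1 sF1 A11) \<inter> dmn (op_adjoint sE2 sF1 A12)"
  define D2 where "D2 = dmn (op_adjoint sE1 sF2 A21) \<inter> dmn (op_adjoint sE2 sF2 A22)"
  have dmn: "dmn ?Ax = join_dual ` (D1 \<times> D2)"
    by (simp add: formal_adjoint_def on_dual_sums_def op_matrix_def D1_def D2_def)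
  note adj = op_adjointD[OF D(1), of _ sE1 sF1] op_adjointD[OF D(2), of _ sE2 sF1]
    op_adjointD[OF D(3), of _ sE1 sF2] op_adjointD[OF D(4), of _ sE2 sF2]
  show le: "op_le ?Ax ?A'"
    unfolding op_le_def
  proof -
    have "g \<in> dmn ?A' \<and> app ?Ax g = app ?A' g" if "g \<in> dmn ?Ax" for g
    proof -
      obtain g1 g2 where g: "g = join_dual (g1, g2)" and g1: "g1 \<in> D1" and g2: "g2 \<in> D2"
        using \<open>g \<in> dmn ?Ax\<close> by (auto simp: dmn)
      have dual: "g1 \<in> dual sF1" "g2 \<in> dual sF2"
        using g1 g2 adj by (auto simp: D1_def D2_def)
      \<comment> \<open>\<open>?h1\<close> and \<open>?h2\<close> are the restrictions of the
        required functional to the two summands of \<open>E\<close>.\<close>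
      let ?h1 = "app (op_adjoint sE1 sF1 A11) g1 + app (op_adjoint sE1 sF2 A21) g2"
      let ?h2 = "app (op_adjoint sE2 sF1 A12) g1 + app (op_adjoint sE2 sF2 A22) g2"
      have app: "app ?Ax g = join_dual (?h1, ?h2)"
        by (simp add: formal_adjoint_def on_dual_sums_def op_matrix_def g split_dual_join_dual[OF F dual])
      have h: "?h1 \<in> dual sE1" "?h2 \<in> dual sE2"
        using g1 g2 adj by (auto simp: D1_def D2_def intro!: dual_add E)
      have "g (app ?A f) = app ?Ax g f" if "f \<in> dmn ?A" for f
      proof -
        have "g1 (x + y) = g1 x + g1 y" "g2 (x' + y') = g2 x' + g2 y'" for x y x' y'
          using dual by (auto simp: dual_iff F)
        then show ?thesis
          using that g1 g2 unfolding app unfolding g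
          by (auto simp: op_matrix_def join_dual_def D1_def D2_def adj algebra_simps)
      qed
      moreover have "g \<in> dual (prod_scale sF1 sF2)" "app ?Ax g \<in> dual (prod_scale sE1 sE2)"
        using join_dual_in_dual[OF F dual] join_dual_in_dual[OF E h] unfolding app by (simp_all add: g)
      ultimately show ?thesis
        using op_adjoint_eqI[OF A] by metis
    qed
    then show "dmn ?Ax \<subseteq> dmn ?A' \<and> (\<forall>g\<in>dmn ?Ax. app ?Ax g = app ?A' g)" by blast
  qed
  note lin = linear_operator_op_adjoint[OF E(1) F(1) D(1)] linear_operator_op_adjoint[OF E(2) F(1) D(2)]
    linear_operator_op_adjoint[OF E(1) F(2) D(3)] linear_operator_op_adjoint[OF E(2) F(2) D(4)]
  note lin = lin[unfolded linear_operator_iff[OF module_fun_scale]]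
  have D1: "0 \<in> D1" "\<And>g h. g \<in> D1 \<Longrightarrow> h \<in> D1 \<Longrightarrow> g + h \<in> D1" "\<And>c g. g \<in> D1 \<Longrightarrow> fun_scale c g \<in> D1"
    and D2: "0 \<in> D2" "\<And>g h. g \<in> D2 \<Longrightarrow> h \<in> D2 \<Longrightarrow> g + h \<in> D2" "\<And>c g. g \<in> D2 \<Longrightarrow> fun_scale c g \<in> D2"
    using lin by (simp_all add: D1_def D2_def)
  show "linear_operator fun_scale (weak_star (prod_scale sF1 sF2)) fun_scale (weak_star (prod_scale sE1 sE2)) ?Ax"
  proof (rule linear_operator_op_le[OF module_fun_scale _ le])
    show "linear_operator fun_scale (weak_star (prod_scale sF1 sF2)) fun_scale (weak_star (prod_scale sE1 sE2)) ?A'"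
      by (intro linear_operator_op_adjoint vector_space_prod_scale E F A)
    show "0 \<in> dmn ?Ax"
      unfolding dmn using D1(1) D2(1)
      by (intro image_eqI[of _ _ "(0, 0)"]) (auto simp: join_dual_def fun_eq_iff)
    show "g + h \<in> dmn ?Ax" if "g \<in> dmn ?Ax" "h \<in> dmn ?Ax" for g h
    proof -
      obtain g1 g2 where g: "g = join_dual (g1, g2)" "g1 \<in> D1" "g2 \<in> D2"
        using \<open>g \<in> dmn ?Ax\<close> by (auto simp: dmn)
      obtain h1 h2 where h: "h = join_dual (h1, h2)" "h1 \<in> D1" "h2 \<in> D2"
        using \<open>h \<in> dmn ?Ax\<close> by (auto simp: dmn)
      have "g + h = join_dual (g1 + h1, g2 + h2)"
        by (simp add: g(1) h(1) join_dual_def fun_eq_iff algebra_simps)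
      then show ?thesis using g h D1(2) D2(2) by (auto simp: dmn)
    qed
    show "fun_scale c g \<in> dmn ?Ax" if "g \<in> dmn ?Ax" for c g
    proof -
      obtain g1 g2 where "g = join_dual (g1, g2)" and mem: "g1 \<in> D1" "g2 \<in> D2"
        using \<open>g \<in> dmn ?Ax\<close> by (auto simp: dmn)
      then have "fun_scale c g = join_dual (fun_scale c g1, fun_scale c g2)"
        by (simp add: join_dual_def fun_scale_def fun_eq_iff algebra_simps)
      then show ?thesis using mem D1(3) D2(3) by (auto simp: dmn)
    qed
  qed
qed

theorem theorem6p1:
  fixes sE1 :: "'k::real_or_complex \<Rightarrow> 'e1::{topological_ab_group_add, t2_space} \<Rightarrow> 'e1"
    and sE2 :: "'k \<Rightarrow> 'e2::{topological_ab_group_add, t2_space} \<Rightarrow> 'e2"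
    and sF1 :: "'k \<Rightarrow> 'f1::{topological_ab_group_add, t2_space} \<Rightarrow> 'f1"
    and sF2 :: "'k \<Rightarrow> 'f2::{topological_ab_group_add, t2_space} \<Rightarrow> 'f2"
    and A11 :: "('e1, 'f1) operator" and A12 :: "('e2, 'f1) operator"
    and A21 :: "('e1, 'f2) operator" and A22 :: "('e2, 'f2) operator"
  assumes "locally_convex_hausdorff_space sE1" "locally_convex_hausdorff_space sE2"
    and "locally_convex_hausdorff_space sF1" "locally_convex_hausdorff_space sF2"
    and "linear_operator sE1 euclidean sF1 euclidean A11" "densely_defined euclidean A11"
    and "linear_operator sE2 euclidean sF1 euclidean A12" "densely_defined euclidean A12"
    and "linear_operator sE1 euclidean sF2 euclidean A21" "densely_defined euclidean A21"
    and "linear_operator sE2 euclidean sF2 euclidean A22" "densely_defined euclidean A22"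
    and "closure (dmn A11 \<inter> dmn A21) = UNIV" "closure (dmn A12 \<inter> dmn A22) = UNIV"
  shows "op_le (formal_adjoint sE1 sE2 sF1 sF2 A11 A12 A21 A22)
           (op_adjoint (prod_scale sE1 sE2) (prod_scale sF1 sF2) (op_matrix A11 A12 A21 A22)) \<and>
         closable fun_scale (weak_star (prod_scale sF1 sF2)) fun_scale (weak_star (prod_scale sE1 sE2))
           (formal_adjoint sE1 sE2 sF1 sF2 A11 A12 A21 A22) \<and>
         (densely_defined (weak_star (prod_scale sF1 sF2))
             (formal_adjoint sE1 sE2 sF1 sF2 A11 A12 A21 A22) \<longrightarrow>
           closable (prod_scale sE1 sE2) euclidean (prod_scale sF1 sF2) euclidean
             (op_matrix A11 A12 A21 A22))"
proof -
  interpret E1: locally_convex_hausdorff_space sE1 by fact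
  interpret E2: locally_convex_hausdorff_space sE2 by fact
  interpret F1: locally_convex_hausdorff_space sF1 by fact
  interpret F2: locally_convex_hausdorff_space sF2 by fact
  note E = E1.vector_space_axioms E2.vector_space_axioms
  note F = F1.vector_space_axioms F2.vector_space_axioms
  have D: "closure (dmn A11) = UNIV" "closure (dmn A12) = UNIV"
    "closure (dmn A21) = UNIV" "closure (dmn A22) = UNIV"
    using assms by (simp_all add: densely_defined_def)
  have A: "closure (dmn (op_matrix A11 A12 A21 A22)) = UNIV"
    using assms(13,14) by (simp add: op_matrix_def closure_Times)
  note le = formal_adjoint_op_le[OF E F D assms(13,14)]
  show ?thesis
  proof (intro conjI impI)
    show "closable fun_scale (weak_star (prod_scale sF1 sF2)) fun_scale (weak_star (prod_scale sE1 sE2))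
        (formal_adjoint sE1 sE2 sF1 sF2 A11 A12 A21 A22)"
      by (intro closable_if_op_le_adjoint[OF _ _ A _ le] vector_space_prod_scale E F
          linear_operator_formal_adjoint D assms(13,14))
    assume "densely_defined (weak_star (prod_scale sF1 sF2)) (formal_adjoint sE1 sE2 sF1 sF2 A11 A12 A21 A22)"
    then show "closable (prod_scale sE1 sE2) euclidean (prod_scale sF1 sF2) euclidean (op_matrix A11 A12 A21 A22)"
      \<comment> \<open>The formal adjoint takes the role of \<open>S\<close>; the closing
        \<open>rule\<close> supplies continuity of addition on \<open>E\<close> and
        \<open>F\<close>.\<close>
      by (intro closable_if_adjoint_dense[OF _ _ _ A _ _ _ _ _ le] linear_operator_op_matrix
          vector_space_prod_scale[OF E, folded module_iff_vector_space] vector_space_prod_scale E F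
          continuous_map_prod_scale dual_prod_separates assms)
        (rule continuous_map_add_prod)+
  qed (rule le)
qed

end
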